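(* Let $G$ be a connected irregular graph of order $n$ and diameter $D$, let $\Delta(G)$ be its maximum degree and $\mu(G)$ the largest eigenvalue of its adjacency matrix. Then \[ \Delta(G)-\mu(G)>\frac{1}{(D+2)n}. \] Moreover, this bound is tight up to a constant factor: there is an absolute constant $C>0$ such that for arbitrarily large $n$ and $D$ there exist connected irregular graphs $G$ of order $n$ and diameter $D$ with $\Delta(G)-\mu(G)<\frac{C}{(D+2)n}$.
   Context: A graph is irregular if not all its vertices have the same degree. Graphs are finite and simple. *)

theory Defs
  imports
    "Graph_Theory.Digraph_Component"
    "Graph_Theory.Shortest_Path"
    "Jordan_Normal_Form.Spectral_Radius"
begin

text \<open>
  Finite simple graphs are the symmetric digraphs of the locale \<^locale>\<open>graph\<close> (finite, no loops,
  no parallel arcs): an edge \<open>uv\<close> is the pair of arcs \<open>u \<rightarrow> v\<close> and \<open>v \<rightarrow> u\<close>. Hence the degree of a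
  vertex is its out-degree.
\<close>

definition irregular :: "('a, 'b) pre_digraph \<Rightarrow> bool" where
  "irregular G \<longleftrightarrow> (\<exists>u\<in>verts G. \<exists>v\<in>verts G. out_degree G u \<noteq> out_degree G v)"

definition max_degree :: "('a, 'b) pre_digraph \<Rightarrow> nat" where
  "max_degree G = Max (out_degree G ` verts G)"

text \<open>
  With unit arc weights, \<^const>\<open>wf_digraph.\<mu>\<close> is the usual distance, i.e. the least length of a walk.
  It takes values in the extended reals, and is infinite if there is no walk.
\<close>

definition diameter :: "('a, 'b) pre_digraph \<Rightarrow> ereal" where
  "diameter G = (SUP u\<in>verts G. SUP v\<in>verts G. wf_digraph.\<mu> G (\<lambda>_. 1) u v)"

definition adjacency_matrix :: "('a, 'b) pre_digraph \<Rightarrow> 'a list \<Rightarrow> real mat" where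
  "adjacency_matrix G vs =
     mat (length vs) (length vs) (\<lambda>(i, j). if vs ! i \<rightarrow>\<^bsub>G\<^esub> vs ! j then 1 else 0)"

text \<open>
  The choice of the vertex enumeration is immaterial: adjacency matrices of \<open>G\<close> for different
  enumerations are conjugate by permutation matrices and so have the same eigenvalues. They are
  real symmetric, so all their complex eigenvalues are real.
\<close>

definition largest_eigenvalue :: "('a, 'b) pre_digraph \<Rightarrow> real" where
  "largest_eigenvalue G =
     Max (spectrum (adjacency_matrix G (SOME vs. distinct vs \<and> set vs = verts G)))"

end

theory Submission
  imports Defs
begin

text \<open>
  Lower bound: for a real eigenvector \<open>f\<close> of the largest eigenvalue \<open>\<mu>\<close> one has
  \<open>(\<Delta> - \<mu>) \<Sum>\<^sub>u f(u)\<^sup>2 = \<Sum>\<^sub>u (\<Delta> - d(u)) f(u)\<^sup>2 + \<Sum>\<^sub>u\<^sub>v (f(u) - f(v))\<^sup>2\<close>, the last sum running over the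
  edges. Let \<open>\<bar>f\<bar>\<close> be maximal at \<open>s\<close>, choose \<open>t\<close> with \<open>d(t) < \<Delta>\<close>, and keep only the term
  \<open>f(t)\<^sup>2\<close> and the edges of a shortest path from \<open>t\<close> to \<open>s\<close>. By Cauchy--Schwarz the right-hand side
  is at least \<open>f(s)\<^sup>2 / (D + 1)\<close>, while \<open>\<Sum>\<^sub>u f(u)\<^sup>2 \<le> n f(s)\<^sup>2\<close>. So even \<open>\<Delta> - \<mu> \<ge> 1 / ((D + 1) n)\<close>.

  Tightness: the path on \<open>n\<close> vertices has \<open>D = n - 1\<close> and eigenvalue \<open>2 cos (\<pi> / (n + 1))\<close>, so
  \<open>\<Delta> - \<mu> \<le> \<pi>\<^sup>2 / (n + 1)\<^sup>2 < \<pi>\<^sup>2 / ((D + 2) n)\<close>.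
\<close>

subsection \<open>Eigenvectors of the adjacency matrix\<close>

text \<open>A real matrix need not have a real eigenvalue, so the eigenvalue \<open>k\<close> is
  taken over the complex numbers. Symmetry forces \<open>Im k = 0\<close>, and then the real or the
  imaginary part of the eigenvector is a real eigenvector.\<close>

lemma real_symmetric_spectrum_nonempty:
  fixes A :: "real mat"
  assumes A: "A \<in> carrier_mat n n" and n: "n > 0"
    and sym: "\<And>i j. i < n \<Longrightarrow> j < n \<Longrightarrow> A $$ (i, j) = A $$ (j, i)"
  shows "spectrum A \<noteq> {}"
proof -
  define B where "B = map_mat complex_of_real A"
  have B: "B \<in> carrier_mat n n" using A by (simp add: B_def)
  obtain k where "eigenvalue B k"
    using spectrum_non_empty[OF B n] by (auto simp: spectrum_def)
  then obtain v where v: "v \<in> carrier_vec n" "v \<noteq> 0\<^sub>v n" and ev: "B *\<^sub>v v = k \<cdot>\<^sub>v v"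
    using B unfolding eigenvalue_def eigenvector_def by auto
  define a b where "a i = Re (v $ i)" and "b i = Im (v $ i)" for i
  have row: "(\<Sum>j<n. complex_of_real (A $$ (i, j)) * v $ j) = k * v $ i" if "i < n" for i
  proof -
    have "(B *\<^sub>v v) $ i = (\<Sum>j<n. complex_of_real (A $$ (i, j)) * v $ j)"
      using that A v by (auto simp: B_def scalar_prod_def lessThan_atLeast0 intro!: sum.cong)
    moreover have "(k \<cdot>\<^sub>v v) $ i = k * v $ i"
      using that v by simp
    ultimately show ?thesis using ev by simp
  qed
  have rowa: "(\<Sum>j<n. A $$ (i, j) * a j) = Re k * a i - Im k * b i"
    and rowb: "(\<Sum>j<n. A $$ (i, j) * b j) = Re k * b i + Im k * a i" if "i < n" for i
    using arg_cong[OF row[OF that], of Re] arg_cong[OF row[OF that], of Im]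
    by (simp_all add: a_def b_def)
  have pos: "(\<Sum>i<n. (a i)\<^sup>2 + (b i)\<^sup>2) \<noteq> 0"
  proof
    assume "(\<Sum>i<n. (a i)\<^sup>2 + (b i)\<^sup>2) = 0"
    then have "\<forall>i<n. (a i)\<^sup>2 + (b i)\<^sup>2 = 0"
      by (subst (asm) sum_nonneg_eq_0_iff) auto
    then have "v = 0\<^sub>v n"
      using v by (intro eq_vecI) (auto simp: a_def b_def sum_power2_eq_zero_iff complex_eq_iff)
    then show False using v by simp
  qed
  \<comment> \<open>The bilinear form of \<open>A\<close> takes the same value on
    \<open>(b, a)\<close> and \<open>(a, b)\<close>. Inserting \<open>rowa\<close> and
    \<open>rowb\<close>, the terms with \<open>Re k\<close> cancel and only \<open>Im k\<close>
    times the squared norm remains.\<close>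
  have "(\<Sum>i<n. b i * (\<Sum>j<n. A $$ (i, j) * a j)) = (\<Sum>i<n. a i * (\<Sum>j<n. A $$ (i, j) * b j))"
    unfolding sum_distrib_left
    by (subst sum.swap) (auto intro!: sum.cong simp: sym)
  then have "(\<Sum>i<n. b i * (Re k * a i - Im k * b i)) = (\<Sum>i<n. a i * (Re k * b i + Im k * a i))"
    using rowa rowb by simp
  then have "Im k * (\<Sum>i<n. (a i)\<^sup>2 + (b i)\<^sup>2) = 0"
    by (simp add: algebra_simps sum.distrib sum_subtractf sum_distrib_left power2_eq_square)
  with pos have "Im k = 0" by simp
  have real_ev: "eigenvalue A (Re k)"
    if "\<And>i. i < n \<Longrightarrow> (\<Sum>j<n. A $$ (i, j) * c j) = Re k * c i" "i < n" "c i \<noteq> 0" for c i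
  proof -
    have "A *\<^sub>v vec n c = Re k \<cdot>\<^sub>v vec n c"
      using A that(1) by (intro eq_vecI) (auto simp: scalar_prod_def lessThan_atLeast0)
    moreover have "vec n c \<noteq> 0\<^sub>v n"
      using that(2,3) by (metis index_vec index_zero_vec(1))
    ultimately show ?thesis
      using A unfolding eigenvalue_def eigenvector_def by (intro exI[of _ "vec n c"]) simp
  qed
  obtain i where "i < n" "a i \<noteq> 0 \<or> b i \<noteq> 0"
    using pos by (metis (no_types, lifting) add_0 lessThan_iff sum.neutral zero_power2)
  with \<open>Im k = 0\<close> have "eigenvalue A (Re k)"
    using real_ev[of a i] real_ev[of b i] rowa rowb by auto
  then show ?thesis by (auto simp: spectrum_def)
qed

text \<open>Replaces eigenvectors by functions on the vertices. The right-hand side does not mention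
  \<open>vs\<close>, so the choice made in \<open>largest_eigenvalue\<close> becomes
  invisible.\<close>

lemma (in fin_digraph) adjacency_spectrum_iff:
  assumes vs: "distinct vs" "set vs = verts G"
  shows "k \<in> spectrum (adjacency_matrix G vs) \<longleftrightarrow>
    (\<exists>f. (\<exists>v\<in>verts G. f v \<noteq> 0) \<and> (\<forall>u\<in>verts G. (\<Sum>v | u \<rightarrow>\<^bsub>G\<^esub> v. f v) = k * f u))"
    (is "_ \<longleftrightarrow> (\<exists>f. ?ev f)")
proof -
  let ?A = "adjacency_matrix G vs" and ?n = "length vs"
  have A: "?A \<in> carrier_mat ?n ?n" by (simp add: adjacency_matrix_def)
  have row: "(\<Sum>j<?n. ?A $$ (i, j) * f (vs ! j)) = (\<Sum>v | vs ! i \<rightarrow>\<^bsub>G\<^esub> v. f v)"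
    if "i < ?n" for i and f :: "'a \<Rightarrow> real"
  proof -
    have "(\<Sum>j<?n. ?A $$ (i, j) * f (vs ! j))
        = (\<Sum>j<?n. if vs ! i \<rightarrow>\<^bsub>G\<^esub> (vs ! j) then f (vs ! j) else 0)"
      using that by (intro sum.cong) (auto simp: adjacency_matrix_def)
    also have "\<dots> = (\<Sum>v\<in>verts G. if vs ! i \<rightarrow>\<^bsub>G\<^esub> v then f v else 0)"
      using bij_betw_nth[OF vs(1) refl vs(2)[symmetric]]
      by (rule sum.reindex_bij_betw)
    also have "\<dots> = (\<Sum>v | vs ! i \<rightarrow>\<^bsub>G\<^esub> v. f v)"
      by (rule sum.mono_neutral_cong_right) (auto dest: adj_in_verts)
    finally show ?thesis .
  qed
  have mult: "(?A *\<^sub>v w) $ i = (\<Sum>j<?n. ?A $$ (i, j) * w $ j)"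
    if "i < ?n" "w \<in> carrier_vec ?n" for i and w :: "real vec"
    using that A by (auto simp: scalar_prod_def lessThan_atLeast0 intro!: sum.cong)
  show ?thesis
  proof
    assume "k \<in> spectrum ?A"
    then obtain w where w: "w \<in> carrier_vec ?n" "w \<noteq> 0\<^sub>v ?n" "?A *\<^sub>v w = k \<cdot>\<^sub>v w"
      using A by (auto simp: spectrum_def eigenvalue_def eigenvector_def)
    \<comment> \<open>Off \<open>verts G\<close> the value is arbitrary, which is harmless because
      neighbours are always vertices.\<close>
    define f where "f v = w $ (SOME i. i < ?n \<and> vs ! i = v)" for v
    have f: "f (vs ! i) = w $ i" if "i < ?n" for i
    proof -
      have "(SOME j. j < ?n \<and> vs ! j = vs ! i) = i"
        using that vs(1) by (intro some_equality) (auto simp: nth_eq_iff_index_eq)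
      then show ?thesis by (simp add: f_def)
    qed
    obtain i where "i < ?n" "w $ i \<noteq> 0"
      using w(1,2) by (metis eq_vecI carrier_vecD index_zero_vec)
    then have "\<exists>v\<in>verts G. f v \<noteq> 0"
      using f vs(2) by (metis nth_mem)
    moreover have "(\<Sum>v | u \<rightarrow>\<^bsub>G\<^esub> v. f v) = k * f u" if "u \<in> verts G" for u
    proof -
      obtain i where i: "i < ?n" "u = vs ! i"
        using \<open>u \<in> verts G\<close> vs(2) by (metis in_set_conv_nth)
      have "(\<Sum>v | u \<rightarrow>\<^bsub>G\<^esub> v. f v) = (\<Sum>j<?n. ?A $$ (i, j) * w $ j)"
        using row[OF i(1), of f] by (simp add: i f)
      also have "\<dots> = (k \<cdot>\<^sub>v w) $ i" using mult[OF i(1) w(1)] w(3) by simp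
      also have "\<dots> = k * f u" using i w(1) by (simp add: f)
      finally show ?thesis .
    qed
    ultimately show "\<exists>f. ?ev f" by blast
  next
    assume "\<exists>f. ?ev f"
    then obtain f where f: "?ev f" by blast
    define w where "w = vec ?n (\<lambda>i. f (vs ! i))"
    have w: "w \<in> carrier_vec ?n" by (simp add: w_def)
    obtain i where "i < ?n" "f (vs ! i) \<noteq> 0"
      using f vs(2) by (metis in_set_conv_nth)
    then have "w \<noteq> 0\<^sub>v ?n"
      by (metis index_vec index_zero_vec(1) w_def)
    moreover have "?A *\<^sub>v w = k \<cdot>\<^sub>v w"
    proof (rule eq_vecI)
      fix i assume "i < dim_vec (k \<cdot>\<^sub>v w)"
      then have i: "i < ?n" by (simp add: w_def)
      have "(?A *\<^sub>v w) $ i = (\<Sum>j<?n. ?A $$ (i, j) * f (vs ! j))"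
        unfolding mult[OF i w] by (simp add: w_def)
      also have "\<dots> = k * f (vs ! i)"
        unfolding row[OF i] using f nth_mem[OF i] unfolding vs(2) by blast
      finally show "(?A *\<^sub>v w) $ i = (k \<cdot>\<^sub>v w) $ i"
        using i by (simp add: w_def)
    qed (use A in \<open>simp add: w_def\<close>)
    ultimately have "eigenvector ?A w k"
      using A w by (simp add: eigenvector_def)
    then show "k \<in> spectrum ?A"
      by (auto simp: spectrum_def eigenvalue_def)
  qed
qed

text \<open>Symmetric arcs give a symmetric matrix. Nonemptiness, with finiteness of the spectrum,
  makes the \<open>Max\<close> in \<open>largest_eigenvalue\<close> an actual eigenvalue.\<close>

lemma (in graph) adjacency_spectrum_nonempty:
  assumes "distinct vs" "set vs = verts G" "verts G \<noteq> {}"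
  shows "spectrum (adjacency_matrix G vs) \<noteq> {}"
proof (rule real_symmetric_spectrum_nonempty)
  show "adjacency_matrix G vs \<in> carrier_mat (length vs) (length vs)"
    by (simp add: adjacency_matrix_def)
  show "0 < length vs" using assms by auto
  show "adjacency_matrix G vs $$ (i, j) = adjacency_matrix G vs $$ (j, i)"
    if "i < length vs" "j < length vs" for i j
    using that arcs_ends_symmetric[OF sym_arcs] by (auto simp: adjacency_matrix_def)
qed

lemma (in fin_digraph) largest_eigenvalue_enum:
  obtains vs where "distinct vs" "set vs = verts G"
    "largest_eigenvalue G = Max (spectrum (adjacency_matrix G vs))"
    "finite (spectrum (adjacency_matrix G vs))"
proof -
  define vs where "vs = (SOME vs. distinct vs \<and> set vs = verts G)"
  have "\<exists>vs. distinct vs \<and> set vs = verts G"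
    using finite_distinct_list[OF finite_verts] by blast
  then have "distinct vs \<and> set vs = verts G"
    unfolding vs_def by (rule someI_ex)
  moreover have "finite (spectrum (adjacency_matrix G vs))"
    by (rule card_finite_spectrum(1)[of _ "length vs"]) (simp add: adjacency_matrix_def)
  ultimately show ?thesis
    using that[of vs] by (simp add: largest_eigenvalue_def vs_def)
qed

lemma (in graph) largest_eigenvalue_eigenvector:
  assumes "verts G \<noteq> {}"
  obtains f where "\<exists>v\<in>verts G. f v \<noteq> 0"
    "\<And>u. u \<in> verts G \<Longrightarrow> (\<Sum>v | u \<rightarrow>\<^bsub>G\<^esub> v. f v) = largest_eigenvalue G * f u"
proof -
  obtain vs where vs: "distinct vs" "set vs = verts G"
    "largest_eigenvalue G = Max (spectrum (adjacency_matrix G vs))"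
    "finite (spectrum (adjacency_matrix G vs))"
    by (rule largest_eigenvalue_enum)
  then have "largest_eigenvalue G \<in> spectrum (adjacency_matrix G vs)"
    using adjacency_spectrum_nonempty assms by simp
  then show ?thesis
    using that unfolding adjacency_spectrum_iff[OF vs(1,2)] by blast
qed

text \<open>Serves the tightness part: a single explicit eigenfunction of the path bounds its
  largest eigenvalue from below.\<close>

lemma (in fin_digraph) eigenvalue_le_largest_eigenvalue:
  assumes "v \<in> verts G" "f v \<noteq> 0"
    and "\<And>u. u \<in> verts G \<Longrightarrow> (\<Sum>v | u \<rightarrow>\<^bsub>G\<^esub> v. f v) = k * f u"
  shows "k \<le> largest_eigenvalue G"
proof -
  obtain vs where vs: "distinct vs" "set vs = verts G"
    "largest_eigenvalue G = Max (spectrum (adjacency_matrix G vs))"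
    "finite (spectrum (adjacency_matrix G vs))"
    by (rule largest_eigenvalue_enum)
  moreover have "k \<in> spectrum (adjacency_matrix G vs)"
    unfolding adjacency_spectrum_iff[OF vs(1,2)] using assms by blast
  ultimately show ?thesis by simp
qed

subsection \<open>Lower bound for the gap\<close>

text \<open>The inductive step of Cauchy--Schwarz: with \<open>k\<close> increments of sum
  \<open>a\<close> and \<open>q\<close> the sum of their squares, one more increment
  \<open>b\<close> is added. The mixed term is bounded by expanding \<open>(a - k * b)^2\<close> and
  dividing by \<open>k\<close>, hence the separate case \<open>k = 0\<close>.\<close>

lemma square_add_le:
  fixes a b k q :: real
  assumes "a\<^sup>2 \<le> k * q" "0 \<le> q" "0 \<le> k"
  shows "(a + b)\<^sup>2 \<le> (k + 1) * (q + b\<^sup>2)"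
proof (cases "k = 0")
  case True
  with assms show ?thesis by simp
next
  case False
  have "2 * a * b * k \<le> a\<^sup>2 + (k * b)\<^sup>2"
    using zero_le_power2[of "a - k * b"] by (simp add: power2_diff algebra_simps)
  also have "\<dots> \<le> k * (q + k * b\<^sup>2)"
    using assms(1) by (simp add: power2_eq_square algebra_simps)
  finally have "2 * a * b \<le> q + k * b\<^sup>2"
    using False assms(3) by (simp add: mult.commute[of _ k])
  with assms(1) show ?thesis by (simp add: power2_sum algebra_simps)
qed

section \<open>Sums of squared differences over arcs\<close>

lemma (in digraph) out_degree_eq_card_neighbours:
  "out_degree G u = card {v. u \<rightarrow>\<^bsub>G\<^esub> v}"
proof -
  have "{v. u \<rightarrow>\<^bsub>G\<^esub> v} = head G ` out_arcs G u"
    by (auto simp: arcs_ends_conv)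
  moreover have "inj_on (head G) (out_arcs G u)"
    by (auto simp: inj_on_def arc_to_ends_def intro: no_multi_arcs)
  ultimately show ?thesis by (simp add: out_degree_def card_image)
qed

lemma (in fin_digraph) finite_arcs_ends: "finite (arcs_ends G)"
  by (simp add: arcs_ends_def)

text \<open>Expand the square. Reversal of arcs makes both square terms equal to the degree-weighted
  sum, and the factor 2 arises because every edge is a pair of arcs.\<close>

lemma (in graph) laplacian_quadratic_form:
  fixes f :: "'a \<Rightarrow> real"
  shows "(\<Sum>(u, v)\<in>arcs_ends G. (f u - f v)\<^sup>2)
    = 2 * (\<Sum>u\<in>verts G. out_degree G u * (f u)\<^sup>2)
      - 2 * (\<Sum>u\<in>verts G. f u * (\<Sum>v | u \<rightarrow>\<^bsub>G\<^esub> v. f v))"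
proof -
  define N where "N u = {v. u \<rightarrow>\<^bsub>G\<^esub> v}" for u
  have E: "arcs_ends G = Sigma (verts G) N"
    by (auto simp: N_def dest: adj_in_verts)
  have fin: "finite (N u)" for u
    by (rule finite_subset[OF _ finite_verts]) (auto simp: N_def dest: adj_in_verts)
  have tails: "(\<Sum>(u, v)\<in>arcs_ends G. (f u)\<^sup>2) = (\<Sum>u\<in>verts G. out_degree G u * (f u)\<^sup>2)"
    by (simp add: E sum.Sigma[symmetric] fin out_degree_eq_card_neighbours flip: N_def)
  have "(\<Sum>(u, v)\<in>arcs_ends G. (f v)\<^sup>2) = (\<Sum>(u, v)\<in>arcs_ends G. (f u)\<^sup>2)"
    by (rule sum.reindex_bij_witness[of _ prod.swap prod.swap])
      (auto intro: arcs_ends_symmetric[OF sym_arcs])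
  moreover have "(\<Sum>(u, v)\<in>arcs_ends G. f u * f v)
      = (\<Sum>u\<in>verts G. f u * (\<Sum>v | u \<rightarrow>\<^bsub>G\<^esub> v. f v))"
    by (simp add: E sum.Sigma[symmetric] fin sum_distrib_left flip: N_def)
  moreover have "(\<Sum>(u, v)\<in>arcs_ends G. (f u - f v)\<^sup>2)
      = (\<Sum>(u, v)\<in>arcs_ends G. (f u)\<^sup>2) + (\<Sum>(u, v)\<in>arcs_ends G. (f v)\<^sup>2)
        - 2 * (\<Sum>(u, v)\<in>arcs_ends G. f u * f v)"
    by (simp add: case_prod_unfold power2_diff sum.distrib sum_subtractf sum_distrib_left mult.assoc)
  ultimately show ?thesis
    unfolding tails[symmetric] by linarith
qed

text \<open>An edge with distinct end values has exactly one ascending arc, and the other edges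
  contribute 0. Ascending arcs thus count each relevant edge once, which cancels the factor 2 of the
  quadratic form.\<close>

lemma (in graph) sum_ascending_arcs:
  fixes f :: "'a \<Rightarrow> real"
  shows "(\<Sum>(u, v)\<in>arcs_ends G. (f u - f v)\<^sup>2)
    = 2 * (\<Sum>(u, v) | u \<rightarrow>\<^bsub>G\<^esub> v \<and> f u < f v. (f u - f v)\<^sup>2)"
proof -
  let ?E = "arcs_ends G" and ?q = "\<lambda>(u, v). (f u - f v)\<^sup>2"
  let ?up = "{(u, v). u \<rightarrow>\<^bsub>G\<^esub> v \<and> f u < f v}" and ?dn = "{(u, v). u \<rightarrow>\<^bsub>G\<^esub> v \<and> f v < f u}"
  have fin: "finite ?up" "finite ?dn"
    by (auto intro: finite_subset[OF _ finite_arcs_ends])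
  have "sum ?q ?E = sum ?q (?up \<union> ?dn)"
    by (rule sum.mono_neutral_right) (auto intro: finite_arcs_ends)
  also have "\<dots> = sum ?q ?up + sum ?q ?dn"
    using fin by (intro sum.union_disjoint) auto
  also have "sum ?q ?dn = sum ?q ?up"
    by (rule sum.reindex_bij_witness[of _ prod.swap prod.swap])
      (auto intro: arcs_ends_symmetric[OF sym_arcs] simp: power2_commute)
  finally show ?thesis by simp
qed

text \<open>
  The arcs of \<open>P\<close> stay inside the path so that an arc at a new first vertex is not counted twice.
  The bound \<open>x\<close> replaces \<open>f v - f u\<close>, which may be negative.
\<close>

lemma (in fin_digraph) apath_ascending_energy:
  fixes f :: "'a \<Rightarrow> real"
  assumes "apath u p v"
  shows "\<exists>P x. P \<subseteq> {(a, b). a \<rightarrow>\<^bsub>G\<^esub> b \<and> f a < f b}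
    \<and> P \<subseteq> set (awalk_verts u p) \<times> set (awalk_verts u p)
    \<and> 0 \<le> x \<and> f v - f u \<le> x \<and> x\<^sup>2 \<le> length p * (\<Sum>(a, b)\<in>P. (f a - f b)\<^sup>2)"
  using assms
proof (induction p arbitrary: u)
  case Nil
  then show ?case by (intro exI[of _ "{}"] exI[of _ 0]) (auto simp: apath_Nil_iff)
next
  case (Cons e p)
  let ?q = "\<lambda>(a, b). (f a - f b)\<^sup>2"
  let ?w = "head G e"
  have e: "e \<in> arcs G" "tail G e = u" and p: "apath ?w p v"
    and new: "u \<notin> set (awalk_verts ?w p)"
    using Cons.prems by (auto simp: apath_Cons_iff)
  obtain P x where P: "P \<subseteq> {(a, b). a \<rightarrow>\<^bsub>G\<^esub> b \<and> f a < f b}"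
    "P \<subseteq> set (awalk_verts ?w p) \<times> set (awalk_verts ?w p)"
    and x: "0 \<le> x" "f v - f ?w \<le> x" "x\<^sup>2 \<le> length p * sum ?q P"
    using Cons.IH[OF p] by blast
  have fin: "finite P"
    using P(1) by (auto intro: finite_subset[OF _ finite_arcs_ends])
  have q0: "0 \<le> sum ?q P" by (auto intro: sum_nonneg)
  have uw: "u \<rightarrow>\<^bsub>G\<^esub> ?w" using e by (auto simp: arcs_ends_conv)
  have verts: "set (awalk_verts u (e # p)) = insert u (set (awalk_verts ?w p))"
    using e by simp
  have w: "?w \<in> set (awalk_verts ?w p)"
    using p by (rule hd_in_awalk_verts(2))
  show ?case
  proof (cases "f u < f ?w")
    case True
    let ?P = "insert (u, ?w) P" and ?x = "x + (f ?w - f u)"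
    have "(u, ?w) \<notin> P" using P(2) new by auto
    then have "sum ?q ?P = sum ?q P + (f ?w - f u)\<^sup>2"
      using fin by (simp add: power2_commute)
    moreover have "?x\<^sup>2 \<le> (real (length p) + 1) * (sum ?q P + (f ?w - f u)\<^sup>2)"
      using x(3) q0 by (rule square_add_le) simp
    ultimately have "?x\<^sup>2 \<le> length (e # p) * sum ?q ?P"
      by (simp add: add.commute)
    moreover have "?P \<subseteq> {(a, b). a \<rightarrow>\<^bsub>G\<^esub> b \<and> f a < f b}"
      using P(1) uw True by auto
    moreover have "?P \<subseteq> set (awalk_verts u (e # p)) \<times> set (awalk_verts u (e # p))"
      unfolding verts using P(2) w by auto
    moreover have "0 \<le> ?x" "f v - f u \<le> ?x"
      using x True by auto
    ultimately show ?thesis by blast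
  next
    case False
    \<comment> \<open>The first arc does not ascend, so it is dropped: \<open>f ?w \<le> f u\<close>
      lets the old \<open>x\<close> bound the new difference too.\<close>
    have "x\<^sup>2 \<le> length (e # p) * sum ?q P"
      using x(3) q0 by (simp add: algebra_simps)
    moreover have "P \<subseteq> set (awalk_verts u (e # p)) \<times> set (awalk_verts u (e # p))"
      unfolding verts using P(2) by auto
    moreover have "f v - f u \<le> x" using x False by auto
    ultimately show ?thesis using P(1) x(1) by blast
  qed
qed

section \<open>Shortest paths and the diameter\<close>

lemma (in wf_digraph) awalk_cost_unit: "awalk_cost (\<lambda>_. 1) p = length p"
  by (simp add: awalk_cost_def sum_list_triv)

lemma (in graph) apath_length_le_diameter:
  assumes conn: "Digraph_Component.connected G" and D: "diameter G = ereal (real D)"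
    and uv: "u \<in> verts G" "v \<in> verts G"
  obtains p where "apath u p v" "length p \<le> D"
proof -
  \<comment> \<open>Connectedness refers to the symmetric closure, which has the same reachability
    since the arcs are symmetric already.\<close>
  have "u \<rightarrow>\<^sup>*\<^bsub>G\<^esub> v"
    using conn uv reachable_mk_symmetric_eq[OF sym_arcs]
    by (auto simp: connected_def strongly_connected_def)
  then obtain p where p: "apath u p v" "\<mu> (\<lambda>_. 1) u v = awalk_cost (\<lambda>_. 1) p"
    using min_cost_awalk[of u v "\<lambda>_. 1"] by auto
  have "\<mu> (\<lambda>_. 1) u v \<le> diameter G"
    unfolding diameter_def using uv by (meson SUP_upper2 order_refl)
  then have "length p \<le> D"
    using p(2) D by (simp add: awalk_cost_unit)
  with p(1) that show ?thesis by blast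
qed

text \<open>The factor \<open>D + 1\<close> counts at most \<open>D\<close> increments along the
  path and one more for the value \<open>f t\<close> at its start.\<close>

lemma (in graph) max_degree_gap:
  assumes conn: "Digraph_Component.connected G" and irr: "irregular G"
    and D: "diameter G = ereal (real D)"
  shows "1 / ((real D + 1) * real (card (verts G))) \<le> real (max_degree G) - largest_eigenvalue G"
proof -
  let ?\<Delta> = "max_degree G" and ?l = "largest_eigenvalue G" and ?n = "card (verts G)"
  have deg: "out_degree G u \<le> ?\<Delta>" if "u \<in> verts G" for u
    using that by (simp add: max_degree_def)
  obtain t where t: "t \<in> verts G" "out_degree G t < ?\<Delta>"
    using irr deg unfolding irregular_def by (metis le_neq_implies_less)
  then have n: "0 < ?n" by (auto simp: card_gt_0_iff)
  have ne: "verts G \<noteq> {}" using t(1) by blast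
  obtain g where g: "\<exists>v\<in>verts G. g v \<noteq> 0"
    "\<And>u. u \<in> verts G \<Longrightarrow> (\<Sum>v | u \<rightarrow>\<^bsub>G\<^esub> v. g v) = ?l * g u"
    using largest_eigenvalue_eigenvector[OF ne] by blast
  obtain s where s: "s \<in> verts G" "\<And>u. u \<in> verts G \<Longrightarrow> \<bar>g u\<bar> \<le> \<bar>g s\<bar>"
  proof -
    have "Max ((\<lambda>u. \<bar>g u\<bar>) ` verts G) \<in> (\<lambda>u. \<bar>g u\<bar>) ` verts G"
      using ne by (intro Max_in) auto
    then obtain s where "s \<in> verts G" "Max ((\<lambda>u. \<bar>g u\<bar>) ` verts G) = \<bar>g s\<bar>" by blast
    then show ?thesis using that[of s] by (metis Max_ge finite_imageI finite_verts imageI)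
  qed
  \<comment> \<open>Changing the sign makes the extreme value positive, so that \<open>f s\<close>
    is the maximum of \<open>f\<close> as well as of its absolute value.\<close>
  define f where "f u = sgn (g s) * g u" for u
  have ev: "(\<Sum>v | u \<rightarrow>\<^bsub>G\<^esub> v. f v) = ?l * f u" if "u \<in> verts G" for u
    using g(2)[OF that] by (simp add: f_def sum_distrib_left[symmetric])
  have fs: "f s = \<bar>g s\<bar>" by (simp add: f_def abs_sgn mult.commute)
  have gs: "g s \<noteq> 0" using g(1) s(2) by force
  have fs0: "0 < f s" using gs fs by simp
  have fmax: "\<bar>f u\<bar> \<le> f s" if "u \<in> verts G" for u
    using s(2)[OF that] gs fs by (simp add: f_def abs_mult)
  define S where "S = (\<Sum>u\<in>verts G. (f u)\<^sup>2)"
  define Q where "Q = (\<Sum>(u, v) | u \<rightarrow>\<^bsub>G\<^esub> v \<and> f u < f v. (f u - f v)\<^sup>2)"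
  have "(f u)\<^sup>2 \<le> (f s)\<^sup>2" if "u \<in> verts G" for u
    using fmax[OF that] by (metis abs_ge_zero power2_abs power_mono)
  then have S_le: "S \<le> ?n * (f s)\<^sup>2"
    unfolding S_def by (rule sum_bounded_above)
  have "(\<Sum>u\<in>verts G. f u * (\<Sum>v | u \<rightarrow>\<^bsub>G\<^esub> v. f v)) = ?l * S"
    by (simp add: S_def ev sum_distrib_left power2_eq_square mult.left_commute)
  then have Q: "Q = (\<Sum>u\<in>verts G. out_degree G u * (f u)\<^sup>2) - ?l * S"
    using laplacian_quadratic_form[of f] sum_ascending_arcs[of f] unfolding Q_def by linarith
  \<comment> \<open>Degrees are integers, so the deficit at \<open>t\<close> is at least 1; at every
    other vertex it is nonnegative.\<close>
  have "(f t)\<^sup>2 \<le> (real ?\<Delta> - out_degree G t) * (f t)\<^sup>2"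
    using mult_right_mono[of 1 "real ?\<Delta> - out_degree G t" "(f t)\<^sup>2"] t(2) by simp
  also have "\<dots> \<le> (\<Sum>u\<in>verts G. (real ?\<Delta> - out_degree G u) * (f u)\<^sup>2)"
    using t(1) deg by (intro member_le_sum) auto
  also have "\<dots> = real ?\<Delta> * S - (\<Sum>u\<in>verts G. out_degree G u * (f u)\<^sup>2)"
    by (simp add: S_def left_diff_distrib sum_subtractf sum_distrib_left)
  finally have gap: "(f t)\<^sup>2 + Q \<le> (real ?\<Delta> - ?l) * S"
    using Q by (simp add: algebra_simps)
  obtain p where p: "apath t p s" "length p \<le> D"
    using apath_length_le_diameter[OF conn D t(1) s(1)] .
  obtain P x where P: "P \<subseteq> {(a, b). a \<rightarrow>\<^bsub>G\<^esub> b \<and> f a < f b}"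
    and x: "0 \<le> x" "f s - f t \<le> x" "x\<^sup>2 \<le> length p * (\<Sum>(a, b)\<in>P. (f a - f b)\<^sup>2)"
    using apath_ascending_energy[OF p(1), of f] by blast
  have PQ: "(\<Sum>(a, b)\<in>P. (f a - f b)\<^sup>2) \<le> Q"
    unfolding Q_def using P
    by (intro sum_mono2) (auto intro: finite_subset[OF _ finite_arcs_ends])
  have Q0: "0 \<le> Q" unfolding Q_def by (auto intro: sum_nonneg)
  have "(f s - f t)\<^sup>2 \<le> x\<^sup>2"
    using x(2) fmax[OF t(1)] by (intro power_mono) auto
  also have "\<dots> \<le> length p * Q"
    using x(3) PQ by (meson mult_left_mono of_nat_0_le_iff order_trans)
  also have "\<dots> \<le> D * Q"
    using p(2) Q0 by (simp add: mult_right_mono)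
  \<comment> \<open>The value \<open>f t\<close> is treated as a last increment, which turns
    \<open>D\<close> into \<open>D + 1\<close>.\<close>
  finally have "((f s - f t) + f t)\<^sup>2 \<le> (real D + 1) * (Q + (f t)\<^sup>2)"
    using Q0 by (rule square_add_le) simp
  also have "\<dots> \<le> (real D + 1) * ((real ?\<Delta> - ?l) * S)"
    using gap by (intro mult_left_mono) auto
  finally have key: "(f s)\<^sup>2 \<le> (real D + 1) * ((real ?\<Delta> - ?l) * S)" by simp
  \<comment> \<open>The sign of \<Delta> - \<mu> has to be known before \<open>S\<close> is replaced
    by its upper bound. It follows from \<open>key\<close>, whose left-hand side is
    positive.\<close>
  have "0 < (real D + 1) * ((real ?\<Delta> - ?l) * S)"
    using zero_less_power[OF fs0, of 2] key by linarith
  then have "0 < (real ?\<Delta> - ?l) * S"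
    by (simp add: zero_less_mult_iff)
  moreover have "0 \<le> S" by (simp add: S_def sum_nonneg)
  ultimately have "0 \<le> real ?\<Delta> - ?l" by (simp add: zero_less_mult_iff)
  with S_le have "(real ?\<Delta> - ?l) * S \<le> (real ?\<Delta> - ?l) * (?n * (f s)\<^sup>2)"
    by (rule mult_left_mono)
  from mult_left_mono[OF this, of "real D + 1"]
  have "(f s)\<^sup>2 \<le> (real D + 1) * ((real ?\<Delta> - ?l) * (?n * (f s)\<^sup>2))"
    using key by linarith
  then have "1 * (f s)\<^sup>2 \<le> ((real ?\<Delta> - ?l) * ((real D + 1) * ?n)) * (f s)\<^sup>2"
    by (simp add: mult_ac)
  then have "1 \<le> (real ?\<Delta> - ?l) * ((real D + 1) * ?n)"
    using fs0 by (subst (asm) mult_le_cancel_right_pos) auto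
  then show ?thesis
    using n by (subst pos_divide_le_eq) auto
qed

subsection \<open>Paths\<close>

text \<open>Both orientations of each edge are arcs. Arcs are their own pairs of ends, so
  \<open>arcs_ends\<close> agrees with \<open>arcs\<close> and parallel arcs cannot occur.\<close>

definition path_graph :: "nat \<Rightarrow> (nat, nat \<times> nat) pre_digraph" where
  "path_graph n = \<lparr>verts = {..<n}, arcs = {(i, j). i < n \<and> j < n \<and> (j = Suc i \<or> i = Suc j)},
     tail = fst, head = snd\<rparr>"

lemma verts_path_graph [simp]: "verts (path_graph n) = {..<n}"
  and tail_path_graph [simp]: "tail (path_graph n) = fst"
  and head_path_graph [simp]: "head (path_graph n) = snd"
  and arcs_path_graph:
    "arcs (path_graph n) = {(i, j). i < n \<and> j < n \<and> (j = Suc i \<or> i = Suc j)}"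
  by (simp_all add: path_graph_def)

lemma arcs_ends_path_graph: "arcs_ends (path_graph n) = arcs (path_graph n)"
  by (simp add: arcs_ends_conv)

lemma graph_path_graph: "graph (path_graph n)"
proof
  show "finite (arcs (path_graph n))"
    by (rule finite_subset[of _ "{..<n} \<times> {..<n}"]) (auto simp: arcs_path_graph)
  show "symmetric (path_graph n)"
    by (auto simp: symmetric_def sym_def arcs_ends_path_graph arcs_path_graph)
qed (auto simp: arcs_path_graph arc_to_ends_def)

lemma path_graph_neighbours:
  assumes "u < n"
  shows "{v. u \<rightarrow>\<^bsub>path_graph n\<^esub> v}
    = (if Suc u < n then {Suc u} else {}) \<union> (if 0 < u then {u - 1} else {})"
  using assms by (auto simp: arcs_ends_path_graph arcs_path_graph)

lemma path_graph_sum_neighbours: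
  fixes f :: "nat \<Rightarrow> real"
  assumes "u < n"
  shows "(\<Sum>v | u \<rightarrow>\<^bsub>path_graph n\<^esub> v. f v)
    = (if Suc u < n then f (Suc u) else 0) + (if 0 < u then f (u - 1) else 0)"
  unfolding path_graph_neighbours[OF assms] by (subst sum.union_disjoint) auto

lemma out_degree_path_graph:
  assumes "u < n"
  shows "out_degree (path_graph n) u = (if Suc u < n then 1 else 0) + (if 0 < u then 1 else 0)"
proof -
  interpret graph "path_graph n" by (rule graph_path_graph)
  show ?thesis
    unfolding out_degree_eq_card_neighbours path_graph_neighbours[OF assms]
    by (subst card_Un_disjoint) auto
qed

text \<open>Vertex \<open>0\<close> is an end of degree 1, while vertex \<open>1\<close> is an inner
  vertex of degree 2.\<close>

lemma irregular_path_graph: "3 \<le> n \<Longrightarrow> irregular (path_graph n)"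
  unfolding irregular_def
  by (intro bexI[of _ 0] bexI[of _ 1]) (auto simp: out_degree_path_graph)

lemma max_degree_path_graph: "0 < n \<Longrightarrow> max_degree (path_graph n) \<le> 2"
  unfolding max_degree_def by (subst Max_le_iff) (auto simp: out_degree_path_graph)

section \<open>Distances in the path\<close>

lemma path_graph_awalk:
  assumes "u < n" "v < n"
  shows "\<exists>p. pre_digraph.awalk (path_graph n) u p v \<and> length p \<le> n - 1"
proof -
  interpret graph "path_graph n" by (rule graph_path_graph)
  have up: "\<exists>p. awalk u p (u + k) \<and> length p = k" if "u + k < n" for u k
    using that
  proof (induction k arbitrary: u)
    case 0
    then show ?case by (auto simp: awalk_Nil_iff)
  next
    case (Suc k)
    then obtain p where "awalk (Suc u) p (Suc u + k)" "length p = k"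
      by (metis add_Suc_shift)
    with Suc.prems show ?case
      by (intro exI[of _ "(u, Suc u) # p"]) (auto simp: awalk_Cons_iff arcs_path_graph)
  qed
  have down: "\<exists>p. awalk (u + k) p u \<and> length p = k" if "u + k < n" for u k
    using that
  proof (induction k)
    case 0
    then show ?case by (auto simp: awalk_Nil_iff)
  next
    case (Suc k)
    then obtain p where "awalk (u + k) p u" "length p = k" by auto
    with Suc.prems show ?case
      by (intro exI[of _ "(u + Suc k, u + k) # p"]) (auto simp: awalk_Cons_iff arcs_path_graph)
  qed
  show ?thesis
  proof (cases "u \<le> v")
    case True
    then show ?thesis using up[of u "v - u"] assms by fastforce
  next
    case False
    then show ?thesis using down[of v "u - v"] assms by fastforce
  qed
qed

text \<open>Each arc raises the vertex number by at most 1. Hence the ends \<open>0\<close> and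
  \<open>n - 1\<close> are at distance at least \<open>n - 1\<close>.\<close>

lemma path_graph_awalk_length:
  assumes "pre_digraph.awalk (path_graph n) u p v"
  shows "v \<le> u + length p"
proof -
  interpret graph "path_graph n" by (rule graph_path_graph)
  show ?thesis using assms
  proof (induction p arbitrary: u)
    case (Cons e p)
    then have "e \<in> arcs (path_graph n)" "u = fst e" "v \<le> snd e + length p"
      by (auto simp: awalk_Cons_iff)
    then show ?case by (auto simp: arcs_path_graph)
  qed (simp add: awalk_Nil_iff)
qed

lemma connected_path_graph:
  assumes "0 < n"
  shows "Digraph_Component.connected (path_graph n)"
proof -
  interpret graph "path_graph n" by (rule graph_path_graph)
  have "u \<rightarrow>\<^sup>*\<^bsub>path_graph n\<^esub> v" if "u < n" "v < n" for u v
    using path_graph_awalk[OF that] by (auto simp: reachable_awalk)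
  then show ?thesis
    using assms reachable_mk_symmetric_eq[OF sym_arcs]
    by (auto simp: connected_def strongly_connected_def lessThan_empty_iff)
qed

lemma diameter_path_graph:
  assumes "0 < n"
  shows "diameter (path_graph n) = ereal (real (n - 1))"
proof -
  interpret graph "path_graph n" by (rule graph_path_graph)
  let ?d = "\<mu> (\<lambda>_. 1)"
  have "?d u v \<le> ereal (real (n - 1))" if uv: "u < n" "v < n" for u v
  proof -
    obtain p where "awalk u p v" "length p \<le> n - 1"
      using path_graph_awalk[OF uv] by blast
    then show ?thesis
      using min_cost_le_walk_cost[of u p v "\<lambda>_. 1"]
      by (simp add: awalk_cost_unit) (meson ereal_less_eq(3) of_nat_mono order_trans)
  qed
  then have le: "diameter (path_graph n) \<le> ereal (real (n - 1))"
    unfolding diameter_def by (auto intro!: SUP_least)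
  have "ereal (real (n - 1)) \<le> ?d 0 (n - 1)"
    unfolding \<mu>_def
    by (rule INF_greatest) (use path_graph_awalk_length in \<open>fastforce simp: awalk_cost_unit\<close>)
  also have "\<dots> \<le> diameter (path_graph n)"
    unfolding diameter_def
    by (rule SUP_upper2[of 0], use assms in simp, rule SUP_upper, use assms in simp)
  finally show ?thesis using le by simp
qed

text \<open>The eigenfunction is a sine wave that vanishes at the two virtual positions just beyond
  the ends. The shift \<open>u + 1\<close> is due to numbering from 0.\<close>

lemma largest_eigenvalue_path_graph_ge:
  assumes "0 < n"
  shows "2 * cos (pi / (n + 1)) \<le> largest_eigenvalue (path_graph n)"
proof -
  interpret graph "path_graph n" by (rule graph_path_graph)
  define \<theta> where "\<theta> = pi / (n + 1)"
  define f where "f u = sin (real (u + 1) * \<theta>)" for u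
  have \<theta>: "0 < \<theta>" "\<theta> < pi" using assms by (auto simp: \<theta>_def field_simps)
  have end0: "f n = 0" by (simp add: f_def \<theta>_def add.commute)
  have "2 * cos \<theta> \<le> largest_eigenvalue (path_graph n)"
  proof (rule eigenvalue_le_largest_eigenvalue)
    show "0 \<in> verts (path_graph n)" using assms by simp
    show "f 0 \<noteq> 0" using sin_gt_zero[OF \<theta>] by (simp add: f_def)
    fix u assume "u \<in> verts (path_graph n)"
    then have u: "u < n" by simp
    \<comment> \<open>A missing neighbour would contribute \<open>f n = sin pi = 0\<close> on the
      right and \<open>sin 0 = 0\<close> on the left, so one formula covers the ends too.\<close>
    have "(\<Sum>v | u \<rightarrow>\<^bsub>path_graph n\<^esub> v. f v) = f (Suc u) + sin (real u * \<theta>)"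
    proof -
      have "(if Suc u < n then f (Suc u) else 0) = f (Suc u)"
        using u end0 by (metis Suc_lessI)
      moreover have "(if 0 < u then f (u - 1) else 0) = sin (real u * \<theta>)"
        by (auto simp: f_def)
      ultimately show ?thesis unfolding path_graph_sum_neighbours[OF u] by simp
    qed
    also have "\<dots> = sin (real (u + 1) * \<theta> + \<theta>) + sin (real (u + 1) * \<theta> - \<theta>)"
      by (simp add: f_def algebra_simps)
    also have "\<dots> = 2 * cos \<theta> * f u"
      by (simp add: f_def sin_add sin_diff)
    finally show "(\<Sum>v | u \<rightarrow>\<^bsub>path_graph n\<^esub> v. f v) = 2 * cos \<theta> * f u" .
  qed
  then show ?thesis by (simp add: \<theta>_def add.commute)
qed

text \<open>By the half-angle formula the left-hand side is twice the square of
  \<open>sin (x / 2)\<close>.\<close>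

lemma one_minus_cos_le: "1 - cos x \<le> x\<^sup>2 / 2" for x :: real
proof -
  have "(sin (x / 2))\<^sup>2 \<le> (x / 2)\<^sup>2"
    by (rule abs_le_square_iff[THEN iffD1]) (rule abs_sin_x_le_abs_x)
  then show ?thesis
    using cos_double_sin[of "x / 2"] by (simp add: power_divide)
qed

lemma path_graph_gap:
  assumes "0 < n"
  shows "real (max_degree (path_graph n)) - largest_eigenvalue (path_graph n)
    < pi\<^sup>2 / ((real (n - 1) + 2) * n)"
proof -
  let ?\<theta> = "pi / (n + 1)"
  have "real (max_degree (path_graph n)) - largest_eigenvalue (path_graph n) \<le> 2 * (1 - cos ?\<theta>)"
    using max_degree_path_graph[OF assms] largest_eigenvalue_path_graph_ge[OF assms]
    by (simp add: algebra_simps)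
  also have "\<dots> \<le> ?\<theta>\<^sup>2"
    using one_minus_cos_le[of ?\<theta>] by simp
  also have "\<dots> = pi\<^sup>2 / ((real n + 1) * (real n + 1))"
    by (simp add: power_divide power2_eq_square add.commute)
  \<comment> \<open>Strictness comes from shrinking one factor \<open>n + 1\<close> to
    \<open>n\<close>; the other is \<open>D + 2\<close> for \<open>D = n - 1\<close>.\<close>
  also have "\<dots> < pi\<^sup>2 / ((real n + 1) * n)"
    using assms by (intro divide_strict_left_mono mult_strict_left_mono mult_pos_pos) auto
  also have "real n + 1 = real (n - 1) + 2"
    using assms by simp
  finally show ?thesis .
qed

section \<open>The strict lower bound and its sharpness on paths\<close>

theorem theorem1:
  shows "(\<forall>(G :: ('a, 'b) pre_digraph) (n :: nat) (D :: nat).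
            graph G \<and> Digraph_Component.connected G \<and> irregular G
            \<and> card (verts G) = n \<and> diameter G = ereal (real D)
            \<longrightarrow> real (max_degree G) - largest_eigenvalue G > 1 / ((real D + 2) * real n))
       \<and> (\<exists>C :: real. C > 0 \<and>
            (\<forall>(n\<^sub>0 :: nat) (D\<^sub>0 :: nat). \<exists>n \<ge> n\<^sub>0. \<exists>D \<ge> D\<^sub>0. \<exists>G :: (nat, nat \<times> nat) pre_digraph.
               graph G \<and> Digraph_Component.connected G \<and> irregular G
               \<and> card (verts G) = n \<and> diameter G = ereal (real D)
               \<and> real (max_degree G) - largest_eigenvalue G < C / ((real D + 2) * real n)))"
proof (intro conjI allI impI)
  fix G :: "('a, 'b) pre_digraph" and n D :: nat
  assume *: "graph G \<and> Digraph_Component.connected G \<and> irregular G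
    \<and> card (verts G) = n \<and> diameter G = ereal (real D)"
  then interpret graph G by blast
  have "verts G \<noteq> {}" using * by (auto simp: irregular_def)
  then have "0 < n" using * by (auto simp: card_gt_0_iff)
  \<comment> \<open>Passing from \<open>D + 1\<close> to \<open>D + 2\<close> makes the bound
    strict.\<close>
  then have "1 / ((real D + 2) * real n) < 1 / ((real D + 1) * real n)"
    by (intro divide_strict_left_mono mult_strict_right_mono mult_pos_pos) auto
  also have "\<dots> \<le> real (max_degree G) - largest_eigenvalue G"
    using max_degree_gap * by blast
  finally show "1 / ((real D + 2) * real n) < real (max_degree G) - largest_eigenvalue G" .
next
  show "\<exists>C :: real. C > 0 \<and>
            (\<forall>(n\<^sub>0 :: nat) (D\<^sub>0 :: nat). \<exists>n \<ge> n\<^sub>0. \<exists>D \<ge> D\<^sub>0. \<exists>G :: (nat, nat \<times> nat) pre_digraph.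
               graph G \<and> Digraph_Component.connected G \<and> irregular G
               \<and> card (verts G) = n \<and> diameter G = ereal (real D)
               \<and> real (max_degree G) - largest_eigenvalue G < C / ((real D + 2) * real n))"
  proof (intro exI[of _ "pi\<^sup>2"] conjI allI)
    fix n\<^sub>0 D\<^sub>0 :: nat
    \<comment> \<open>The summand 3 ensures irregularity, and \<open>n - 1\<close>, the diameter of
      the path, is still at least \<open>D\<^sub>0\<close>.\<close>
    define n where "n = n\<^sub>0 + D\<^sub>0 + 3"
    have n: "3 \<le> n" "0 < n" "n\<^sub>0 \<le> n" "D\<^sub>0 \<le> n - 1" by (auto simp: n_def)
    show "\<exists>n \<ge> n\<^sub>0. \<exists>D \<ge> D\<^sub>0. \<exists>G :: (nat, nat \<times> nat) pre_digraph.
        graph G \<and> Digraph_Component.connected G \<and> irregular G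
        \<and> card (verts G) = n \<and> diameter G = ereal (real D)
        \<and> real (max_degree G) - largest_eigenvalue G < pi\<^sup>2 / ((real D + 2) * real n)"
      using n graph_path_graph connected_path_graph irregular_path_graph
        diameter_path_graph path_graph_gap
      by (intro exI[of _ n] exI[of _ "n - 1"] exI[of _ "path_graph n"] conjI) auto
  qed simp
qed

end
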